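(* Let $T$ be a nontrivial tree (at least two vertices) of order $n(T)$ with $l(T)$ leaves. Then $$\gamma^{d}_2(T)\geq \frac{n(T)-l(T)+3}{4},$$ with equality if and only if there is a labeling $S$ of $T$ such that $(T,S)\in\mathscr{T}_1$.
   Context: Graphs are finite and simple. For a vertex $v$ of a graph $G$, $N(v)$ is its open neighborhood, $N[v]=N(v)\cup\{v\}$, $d(v)=|N(v)|$, and $d(u,v)$ denotes distance. A leaf is a vertex of degree $1$; a support vertex is a vertex adjacent to a leaf. For a tree $T$, $l(T)$ and $s(T)$ denote the numbers of leaves and of support vertices, and $n(T)$ its order. A set $D\subseteq V(G)$ is a disjunctive dominating set ($2DD$-set) of $G$ if every vertex $v\notin D$ either has a neighbor in $D$ or has at least two vertices of $D$ at distance exactly $2$ from it; a vertex $v$ is said to be $2D$-dominated by $D$ if $N[v]\cap D\neq\emptyset$ or at least two vertices of $D$ are at distance $2$ from $v$. The disjunctive domination number $\gamma^{d}_2(G)$ is the minimum size of a $2DD$-set; a $2DD$-set of that size is a $\gamma^d_2$-set. Labeled trees: a labeling of a tree $T$ is a partition $S=(S_A,S_B,S_C,S_D)$ of $V(T)$ into four (possibly empty) sets; the status $\mathrm{sta}(v)\in\{A,B,C,D\}$ is the letter $x$ with $v\in S_x$. Operation $\mathscr{O}_1$: choose a vertex $v$ with $\mathrm{sta}(v)=A$; add a new vertex $u$ and the edge $uv$, with $\mathrm{sta}(u)=C$. Operation $\mathscr{O}_3$: choose a vertex $v$ with $\mathrm{sta}(v)=C$ and $d(v)=1$; add a new path $u_1u_2u_3u_4$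 and the edge $u_1v$, with $\mathrm{sta}(u_1)=D$, $\mathrm{sta}(u_2)=B$, $\mathrm{sta}(u_3)=A$, $\mathrm{sta}(u_4)=C$. (Existing vertices keep their statuses.) $\mathscr{T}_1$ is the smallest family of labeled trees that contains $(P_3,S')$, where $S'$ gives both leaves of $P_3$ status $C$ and the central vertex status $A$, and is closed under $\mathscr{O}_1$ and $\mathscr{O}_3$. *)

theory Defs
  imports Complex_Main
begin

definition adj :: "'a set set \<Rightarrow> 'a \<Rightarrow> 'a \<Rightarrow> bool" where
  "adj E u v \<longleftrightarrow> {u, v} \<in> E"

definition simple_graph :: "'a set \<Rightarrow> 'a set set \<Rightarrow> bool" where
  "simple_graph V E \<longleftrightarrow> finite V \<and>
     (\<forall>e\<in>E. \<exists>u v. e = {u, v} \<and> u \<noteq> v \<and> u \<in> V \<and> v \<in> V)"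

definition walk :: "'a set \<Rightarrow> 'a set set \<Rightarrow> 'a list \<Rightarrow> bool" where
  "walk V E xs \<longleftrightarrow> xs \<noteq> [] \<and> set xs \<subseteq> V \<and>
     (\<forall>i < length xs - 1. adj E (xs ! i) (xs ! Suc i))"

definition connected_graph :: "'a set \<Rightarrow> 'a set set \<Rightarrow> bool" where
  "connected_graph V E \<longleftrightarrow>
     (\<forall>u\<in>V. \<forall>v\<in>V. \<exists>xs. walk V E xs \<and> hd xs = u \<and> last xs = v)"

definition has_cycle :: "'a set \<Rightarrow> 'a set set \<Rightarrow> bool" where
  "has_cycle V E \<longleftrightarrow>
     (\<exists>xs. walk V E xs \<and> length xs \<ge> 3 \<and> distinct xs \<and> adj E (last xs) (hd xs))"

definition is_tree :: "'a set \<Rightarrow> 'a set set \<Rightarrow> bool" where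
  "is_tree V E \<longleftrightarrow> simple_graph V E \<and> V \<noteq> {} \<and> connected_graph V E \<and> \<not> has_cycle V E"

definition gdist :: "'a set \<Rightarrow> 'a set set \<Rightarrow> 'a \<Rightarrow> 'a \<Rightarrow> nat" where
  "gdist V E u v = (LEAST n. \<exists>xs. walk V E xs \<and> hd xs = u \<and> last xs = v \<and> length xs = Suc n)"

definition nbhd :: "'a set set \<Rightarrow> 'a \<Rightarrow> 'a set" where
  "nbhd E v = {u. adj E v u}"

definition degree :: "'a set set \<Rightarrow> 'a \<Rightarrow> nat" where
  "degree E v = card (nbhd E v)"

definition leaves :: "'a set \<Rightarrow> 'a set set \<Rightarrow> 'a set" where
  "leaves V E = {v \<in> V. degree E v = 1}"

definition disj_dom_set :: "'a set \<Rightarrow> 'a set set \<Rightarrow> 'a set \<Rightarrow> bool" where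
  "disj_dom_set V E D \<longleftrightarrow> D \<subseteq> V \<and>
     (\<forall>v \<in> V - D. (\<exists>u\<in>D. adj E v u) \<or> card {u \<in> D. gdist V E u v = 2} \<ge> 2)"

definition disj_dom_number :: "'a set \<Rightarrow> 'a set set \<Rightarrow> nat" where
  "disj_dom_number V E = (LEAST k. \<exists>D. disj_dom_set V E D \<and> card D = k)"

datatype status = SA | SB | SC | SD

text \<open>The family T_1 of labeled trees (labeling = status function; only values on V matter).\<close>
inductive in_T1 :: "'a set \<Rightarrow> 'a set set \<Rightarrow> ('a \<Rightarrow> status) \<Rightarrow> bool" where
  base: "\<lbrakk> x \<noteq> y; y \<noteq> z; x \<noteq> z; sta x = SC; sta y = SA; sta z = SC \<rbrakk>
         \<Longrightarrow> in_T1 {x, y, z} {{x, y}, {y, z}} sta"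
| op1: "\<lbrakk> in_T1 V E sta; v \<in> V; sta v = SA; u \<notin> V;
          \<forall>w\<in>V. sta' w = sta w; sta' u = SC \<rbrakk>
         \<Longrightarrow> in_T1 (insert u V) (insert {u, v} E) sta'"
| op3: "\<lbrakk> in_T1 V E sta; v \<in> V; sta v = SC; degree E v = 1;
          u1 \<notin> V; u2 \<notin> V; u3 \<notin> V; u4 \<notin> V; distinct [u1, u2, u3, u4];
          \<forall>w\<in>V. sta' w = sta w;
          sta' u1 = SD; sta' u2 = SB; sta' u3 = SA; sta' u4 = SC \<rbrakk>
         \<Longrightarrow> in_T1 (V \<union> {u1, u2, u3, u4}) (E \<union> {{u1, v}, {u1, u2}, {u2, u3}, {u3, u4}}) sta'"

end

theory Submission
  imports Defs
begin

text \<open>Given a disjunctive dominating set \<open>D\<close>, consider the forest induced by the set \<open>X\<close> of all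
  vertices that lie in \<open>D\<close> or are not leaves. It has at most \<open>card X - 1\<close> edges. Outside \<open>D\<close>, the
  vertices of \<open>X\<close> split into those with a neighbour in \<open>D\<close> (\<open>C1\<close>) and those dominated only at
  distance 2 (\<open>C0\<close>); domination and the fact that non-leaves have two neighbours force so many edges
  at them that a discharging argument gives \<open>card X \<le> 4 * card D - 3\<close>.

  Equality makes every estimate tight: no leaf is in \<open>D\<close>, the set \<open>D\<close> is independent, every leaf
  hangs on \<open>D\<close>, and the remaining vertices form paths with three inner vertices that join two
  vertices of \<open>D\<close>. Starting at a vertex of \<open>D\<close> with two of its neighbours, the labeled tree is then
  grown inside \<open>T\<close>: an edge leaving the current subtree starts at a vertex of \<open>D\<close> (first operation)
  or at a pendant vertex of status C, in which case the whole path to the next vertex of \<open>D\<close>,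
  together with one more neighbour of it, can be attached (second operation). Conversely, the
  vertices of status A always form a dominating set of the right size.\<close>

section \<open>Adjacency and neighbourhoods\<close>

lemma adj_commute: "adj E u v \<longleftrightarrow> adj E v u"
  by (simp add: adj_def insert_commute)

lemma mem_nbhd [simp]: "u \<in> nbhd E v \<longleftrightarrow> adj E v u"
  by (simp add: nbhd_def)

lemma simple_graph_adjD:
  assumes "simple_graph V E" "adj E u v"
  shows "u \<noteq> v" "u \<in> V" "v \<in> V"
  using assms unfolding simple_graph_def adj_def by (fastforce simp: doubleton_eq_iff)+

lemma simple_graph_not_adj_self: "simple_graph V E \<Longrightarrow> \<not> adj E v v"
  using simple_graph_adjD(1) by fast

lemma nbhd_subset: "simple_graph V E \<Longrightarrow> nbhd E v \<subseteq> V"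
  using simple_graph_adjD by fastforce

lemma finite_nbhd: "simple_graph V E \<Longrightarrow> finite (nbhd E v)"
  by (meson finite_subset nbhd_subset simple_graph_def)

lemma nbhd_insert_edge:
  "nbhd (insert {a, b} E) x =
     nbhd E x \<union> (if x = a then {b} else {}) \<union> (if x = b then {a} else {})"
  by (auto simp: nbhd_def adj_def doubleton_eq_iff)

lemma nbhd_Int_singletonD:
  assumes "nbhd E v \<inter> Q = {p}" "adj E v u" "u \<in> Q"
  shows "u = p"
proof -
  have "u \<in> nbhd E v \<inter> Q" using assms(2,3) by simp
  then show ?thesis unfolding assms(1) by simp
qed

section \<open>Walks, and edge counts in forests\<close>

lemma walk_singleton: "walk V E [x] \<longleftrightarrow> x \<in> V"
  by (simp add: walk_def)

lemma walk_Cons_Cons: "walk V E (x # y # ys) \<longleftrightarrow> x \<in> V \<and> adj E x y \<and> walk V E (y # ys)"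
proof -
  have "(\<forall>i < Suc (length ys). adj E ((x # y # ys) ! i) ((x # y # ys) ! Suc i)) \<longleftrightarrow>
        adj E x y \<and> (\<forall>i < length ys. adj E ((y # ys) ! i) ((y # ys) ! Suc i))"
    by (subst All_less_Suc2) simp
  then show ?thesis by (auto simp: walk_def)
qed

lemma walk_take: "walk V E xs \<Longrightarrow> n > 0 \<Longrightarrow> walk V E (take n xs)"
  using set_take_subset[of n xs] by (auto simp: walk_def)

lemma walk_crossing_edge:
  assumes "walk V E xs" "hd xs \<in> S" "last xs \<notin> S"
  shows "\<exists>v\<in>S. \<exists>w. w \<notin> S \<and> adj E v w"
  using assms
proof (induction xs rule: induct_list012)
  case (3 x y zs)
  then show ?case by (cases "y \<in> S") (auto simp: walk_Cons_Cons)
qed (auto simp: walk_def)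

text \<open>On a longest path inside \<open>X\<close>, all neighbours in \<open>X\<close> of its
  first vertex lie on the path, as otherwise the path could be extended. A second such neighbour
  would close a cycle.\<close>

lemma forest_low_degree_vertex:
  assumes G: "simple_graph V E" and acyc: "\<not> has_cycle V E" and X: "X \<subseteq> V" "X \<noteq> {}"
  shows "\<exists>x\<in>X. card (nbhd E x \<inter> X) \<le> 1"
proof (rule ccontr)
  assume neg: "\<not> ?thesis"
  have finX: "finite X" using G X by (meson finite_subset simple_graph_def)
  let ?P = "\<lambda>xs. walk V E xs \<and> distinct xs \<and> set xs \<subseteq> X"
  obtain x0 where "x0 \<in> X" using X by blast
  then have "?P [x0]" using X by (auto simp: walk_singleton)
  moreover have "\<forall>xs. ?P xs \<longrightarrow> length xs < Suc (card X)"
    by (metis card_mono distinct_card finX less_Suc_eq_le)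
  ultimately obtain xs where xs: "?P xs" and mx: "\<And>ys. ?P ys \<Longrightarrow> length ys \<le> length xs"
    using ex_has_greatest_nat[of ?P "[x0]" length "Suc (card X)"] by metis
  then obtain x ys where xys: "xs = x # ys" by (cases xs) (auto simp: walk_def)
  have x: "x \<in> X" using xs xys by auto
  have sub: "nbhd E x \<inter> X \<subseteq> set ys"
  proof
    fix y assume y: "y \<in> nbhd E x \<inter> X"
    then have adj: "adj E y x" by (simp add: adj_commute)
    then have "y \<noteq> x" using G simple_graph_not_adj_self by fast
    moreover have "y \<in> set xs"
    proof (rule ccontr)
      assume "y \<notin> set xs"
      then have "?P (y # xs)" using xs xys y adj X by (auto simp: walk_Cons_Cons)
      then show False using mx by fastforce
    qed
    ultimately show "y \<in> set ys" using xys by auto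
  qed
  have "ys \<noteq> []" using neg x sub by force
  have "\<not> nbhd E x \<inter> X \<subseteq> {ys ! 0}"
  proof
    assume "nbhd E x \<inter> X \<subseteq> {ys ! 0}"
    then have "card (nbhd E x \<inter> X) \<le> card {ys ! 0}" by (intro card_mono) auto
    then show False using neg x by auto
  qed
  then obtain y where "y \<in> nbhd E x \<inter> X" "y \<noteq> ys ! 0" by blast
  then have y: "adj E x y" "y \<in> X" "y \<noteq> ys ! 0" by auto
  then have "y \<in> set ys" using sub by auto
  then obtain i where i: "i < length ys" "ys ! i = y" by (auto simp: in_set_conv_nth)
  \<comment> \<open>Since \<open>y\<close> is not the immediate successor of \<open>x\<close>, the
    prefix of the path ending in \<open>y\<close> has at least three vertices, as
    \<open>has_cycle\<close> demands.\<close>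
  then have "i > 0" using y by (cases i) auto
  let ?c = "take (Suc (Suc i)) xs"
  have "walk V E ?c" "distinct ?c" using xs by (auto intro: walk_take)
  moreover have "length ?c \<ge> 3" using i \<open>i > 0\<close> xys by auto
  moreover have "hd ?c = x" using xys by auto
  moreover have "last ?c = y" using i xys by (auto simp: take_Suc_conv_app_nth)
  ultimately show False using acyc y unfolding has_cycle_def by (metis adj_commute)
qed

text \<open>Twice the number of edges induced by \<open>X\<close>. Summing degrees lets later
  arguments split the sum by vertex classes.\<close>

definition degree_sum :: "'a set set \<Rightarrow> 'a set \<Rightarrow> nat" where
  "degree_sum E X = (\<Sum>u\<in>X. card (nbhd E u \<inter> X))"

lemma degree_sum_singleton: "simple_graph V E \<Longrightarrow> degree_sum E {v} = 0"
  using simple_graph_not_adj_self[of V E v] by (auto simp: degree_sum_def)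

lemma degree_sum_insert:
  assumes G: "simple_graph V E" and fin: "finite X" and x: "x \<notin> X"
  shows "degree_sum E (insert x X) = degree_sum E X + 2 * card (nbhd E x \<inter> X)"
proof -
  have "card (nbhd E u \<inter> insert x X) = card (nbhd E u \<inter> X) + of_bool (u \<in> nbhd E x)" for u
    using fin x by (auto simp: Int_insert_right adj_commute)
  then have "(\<Sum>u\<in>X. card (nbhd E u \<inter> insert x X)) =
      degree_sum E X + (\<Sum>u\<in>X. of_bool (u \<in> nbhd E x))"
    by (simp add: degree_sum_def sum.distrib)
  also have "(\<Sum>u\<in>X. of_bool (u \<in> nbhd E x)) = card (nbhd E x \<inter> X)"
    using fin by (simp add: Int_commute Int_def of_bool_def sum.If_cases)
  finally show ?thesis
    using fin x simple_graph_not_adj_self[OF G, of x] by (simp add: degree_sum_def)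
qed

text \<open>Removing a vertex with at most one neighbour in \<open>X\<close> loses at most one edge,
  which gives the usual bound of \<open>card X - 1\<close> edges by induction. The doubled, additive
  form avoids subtraction on naturals.\<close>

lemma forest_degree_sum:
  assumes G: "simple_graph V E" "\<not> has_cycle V E" and "X \<subseteq> V" "X \<noteq> {}"
  shows "degree_sum E X + 2 \<le> 2 * card X"
proof -
  have "finite X" using assms by (meson finite_subset simple_graph_def)
  then show ?thesis using assms(3,4)
  proof (induction X rule: finite_psubset_induct)
    case (psubset X)
    obtain x where x: "x \<in> X" "card (nbhd E x \<inter> X) \<le> 1"
      using forest_low_degree_vertex[OF G psubset.prems] by blast
    let ?Y = "X - {x}"
    have X: "X = insert x ?Y" using x by auto
    have card: "card X = Suc (card ?Y)" using psubset.hyps x by (metis card.remove)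
    show ?case
    proof (cases "?Y = {}")
      case True
      then have "X = {x}" using x by blast
      then show ?thesis using degree_sum_singleton[OF G(1), of x] by simp
    next
      case False
      have "card (nbhd E x \<inter> ?Y) \<le> 1"
        using x psubset.hyps by (meson Diff_subset Int_mono card_mono finite_Int order_refl order_trans)
      moreover have "degree_sum E ?Y + 2 \<le> 2 * card ?Y"
        using psubset x False by blast
      ultimately show ?thesis
        using card degree_sum_insert[OF G(1), of ?Y x] psubset.hyps X by simp
    qed
  qed
qed

text \<open>For a subset \<open>S\<close> of a forest, \<open>degree_sum E S + 2 = 2 * card S\<close> says that \<open>S\<close> induces
  a subtree; this replaces connectivity of \<open>S\<close>.\<close>

lemma subtree_insert:
  assumes G: "simple_graph V E" "\<not> has_cycle V E" and S: "S \<subseteq> V" "degree_sum E S + 2 = 2 * card S"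
    and vw: "v \<in> S" "w \<notin> S" "adj E v w"
  shows "nbhd E w \<inter> S = {v}" "degree_sum E (insert w S) + 2 = 2 * card (insert w S)"
proof -
  have fin: "finite S" using G S by (meson finite_subset simple_graph_def)
  have "insert w S \<subseteq> V" using S vw simple_graph_adjD[OF G(1)] by blast
  then have "degree_sum E (insert w S) + 2 \<le> 2 * card (insert w S)"
    using forest_degree_sum[OF G] by blast
  \<comment> \<open>Adding \<open>w\<close> raises the degree sum by twice its number of neighbours
    in \<open>S\<close>, but the forest bound rises only by 2 and was already attained by
    \<open>S\<close>.\<close>
  then have "card (nbhd E w \<inter> S) \<le> 1"
    using degree_sum_insert[OF G(1) fin vw(2)] fin vw S by simp
  moreover have v: "v \<in> nbhd E w \<inter> S" using vw by (simp add: adj_commute)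
  ultimately show *: "nbhd E w \<inter> S = {v}"
    using fin by (metis card_le_Suc0_iff_eq finite_Int One_nat_def insert_absorb is_singletonI' is_singleton_the_elem singletonD)
  then show "degree_sum E (insert w S) + 2 = 2 * card (insert w S)"
    using degree_sum_insert[OF G(1) fin vw(2)] fin vw S by simp
qed

section \<open>Induced edges and double counting\<close>

definition induced_edges :: "'a set set \<Rightarrow> 'a set \<Rightarrow> 'a set set" where
  "induced_edges E S = {e \<in> E. e \<subseteq> S}"

lemma nbhd_induced_edges: "v \<in> S \<Longrightarrow> nbhd (induced_edges E S) v = nbhd E v \<inter> S"
  by (auto simp: nbhd_def adj_def induced_edges_def)

lemma induced_edges_singleton: "simple_graph V E \<Longrightarrow> induced_edges E {v} = {}"
  unfolding induced_edges_def simple_graph_def by fastforce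

lemma induced_edges_insert:
  assumes G: "simple_graph V E" and w: "nbhd E w \<inter> S = {v}"
  shows "induced_edges E (insert w S) = insert {w, v} (induced_edges E S)"
proof
  note only = nbhd_Int_singletonD[OF w]
  have "v \<in> nbhd E w \<inter> S" unfolding w by simp
  then have v: "{w, v} \<in> E" "v \<in> S" by (auto simp: adj_def)
  show "induced_edges E (insert w S) \<subseteq> insert {w, v} (induced_edges E S)"
  proof
    fix e assume e: "e \<in> induced_edges E (insert w S)"
    then obtain a b where ab: "e = {a, b}" "a \<noteq> b"
      using G unfolding induced_edges_def simple_graph_def by blast
    have "adj E a b" "adj E b a" "a \<in> insert w S" "b \<in> insert w S"
      using e ab by (auto simp: induced_edges_def adj_def insert_commute)
    moreover have "\<not> adj E w w" by (rule simple_graph_not_adj_self[OF G])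
    ultimately consider "a = w" "b = v" | "b = w" "a = v" | "a \<in> S" "b \<in> S"
      using only by (metis insertE)
    then show "e \<in> insert {w, v} (induced_edges E S)"
      using ab e by cases (auto simp: induced_edges_def)
  qed
  show "insert {w, v} (induced_edges E S) \<subseteq> induced_edges E (insert w S)"
    using v by (auto simp: induced_edges_def)
qed

lemma sum_card_nbhd_swap:
  assumes "finite P" "finite Q"
  shows "(\<Sum>u\<in>P. card (nbhd E u \<inter> Q)) = (\<Sum>u\<in>Q. card (nbhd E u \<inter> P))"
proof -
  have *: "card (nbhd E u \<inter> B) = (\<Sum>w\<in>B. of_bool (adj E u w))" if "finite B" for u B
    using that by (simp add: of_bool_def sum.If_cases Int_def conj_commute)
  show ?thesis
    unfolding *[OF assms(1)] *[OF assms(2)]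
    by (subst sum.swap) (simp add: adj_commute)
qed

section \<open>Disjunctive domination through common neighbours\<close>

lemma gdist_eq_2_imp:
  assumes "connected_graph V E" "u \<in> V" "v \<in> V" "gdist V E u v = 2"
  shows "\<exists>w. adj E v w \<and> adj E w u"
proof -
  let ?P = "\<lambda>n. \<exists>xs. walk V E xs \<and> hd xs = u \<and> last xs = v \<and> length xs = Suc n"
  obtain xs where "walk V E xs" "hd xs = u" "last xs = v"
    using assms unfolding connected_graph_def by blast
  then have "?P (length xs - 1)" by (intro exI[of _ xs]) (auto simp: walk_def)
  then have "?P (gdist V E u v)" unfolding gdist_def by (rule LeastI)
  then obtain ys where ys: "walk V E ys" "hd ys = u" "last ys = v" "length ys = Suc 2"
    using assms(4) by auto
  then obtain a b c where "ys = [a, b, c]"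
    by (auto simp: length_Suc_conv numeral_2_eq_2)
  then show ?thesis using ys by (auto simp: walk_Cons_Cons adj_commute)
qed

lemma gdist_eq_2I:
  assumes G: "simple_graph V E" and "u \<noteq> v" "\<not> adj E v u" and w: "adj E v w" "adj E w u"
  shows "gdist V E u v = 2"
  unfolding gdist_def
proof (rule Least_equality)
  have "walk V E [u, w, v]"
    using w simple_graph_adjD[OF G] by (auto simp: walk_Cons_Cons walk_singleton adj_commute)
  then show "\<exists>xs. walk V E xs \<and> hd xs = u \<and> last xs = v \<and> length xs = Suc 2"
    by (intro exI[of _ "[u, w, v]"]) auto
next
  fix n assume "\<exists>xs. walk V E xs \<and> hd xs = u \<and> last xs = v \<and> length xs = Suc n"
  then obtain xs where xs: "walk V E xs" "hd xs = u" "last xs = v" "length xs = Suc n" by blast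
  show "2 \<le> n"
  proof (rule ccontr)
    assume "\<not> 2 \<le> n"
    then consider "n = 0" | "n = 1" by linarith
    then show False
    proof cases
      case 1
      then show False using xs \<open>u \<noteq> v\<close> by (auto simp: length_Suc_conv)
    next
      case 2
      then show False using xs \<open>\<not> adj E v u\<close>
        by (auto simp: length_Suc_conv walk_Cons_Cons adj_commute)
    qed
  qed
qed

text \<open>Reachability by a walk of exactly two edges. It agrees with distance 2 once the two
  vertices are distinct and nonadjacent.\<close>

definition common_nbr :: "'a set set \<Rightarrow> 'a \<Rightarrow> 'a \<Rightarrow> bool" where
  "common_nbr E v u \<longleftrightarrow> (\<exists>w. adj E v w \<and> adj E w u)"

definition dd_dominated :: "'a set set \<Rightarrow> 'a set \<Rightarrow> 'a \<Rightarrow> bool" where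
  "dd_dominated E D v \<longleftrightarrow> (\<exists>u\<in>D. adj E v u) \<or>
     (\<exists>d\<in>D. \<exists>d'\<in>D. d \<noteq> d' \<and> common_nbr E v d \<and> common_nbr E v d')"

lemma two_le_card_iff: "finite A \<Longrightarrow> 2 \<le> card A \<longleftrightarrow> (\<exists>a\<in>A. \<exists>b\<in>A. a \<noteq> b)"
  using card_le_Suc0_iff_eq[of A] by (auto simp: not_less_eq_eq numeral_2_eq_2)

text \<open>The distance condition matters only for a vertex outside \<open>D\<close> without
  neighbours in \<open>D\<close>. For such a vertex, having a common neighbour with a member of
  \<open>D\<close> is the same as being at distance exactly 2 from it.\<close>

lemma disj_dom_set_iff:
  assumes T: "is_tree V E"
  shows "disj_dom_set V E D \<longleftrightarrow> D \<subseteq> V \<and> (\<forall>v\<in>V - D. dd_dominated E D v)"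
proof -
  have G: "simple_graph V E" and C: "connected_graph V E" using T by (auto simp: is_tree_def)
  have "card {u \<in> D. gdist V E u v = 2} \<ge> 2 \<longleftrightarrow>
      (\<exists>d\<in>D. \<exists>d'\<in>D. d \<noteq> d' \<and> common_nbr E v d \<and> common_nbr E v d')"
    if D: "D \<subseteq> V" and v: "v \<in> V - D" and no: "\<not> (\<exists>u\<in>D. adj E v u)" for v
  proof -
    have "finite D" using D G by (meson finite_subset simple_graph_def)
    moreover have "gdist V E u v = 2 \<longleftrightarrow> common_nbr E v u" if "u \<in> D" for u
      using gdist_eq_2_imp[OF C, of u v] gdist_eq_2I[OF G, of u v] that D v no
      by (auto simp: common_nbr_def)
    ultimately show ?thesis by (subst two_le_card_iff) auto
  qed
  then show ?thesis unfolding disj_dom_set_def dd_dominated_def by blast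
qed

lemma disj_dom_number_le: "disj_dom_set V E D \<Longrightarrow> disj_dom_number V E \<le> card D"
  unfolding disj_dom_number_def by (rule Least_le) blast

lemma disj_dom_number_attained: "\<exists>D. disj_dom_set V E D \<and> card D = disj_dom_number V E"
proof -
  have "disj_dom_set V E V" by (simp add: disj_dom_set_def)
  then have "\<exists>k D. disj_dom_set V E D \<and> card D = k" by blast
  then show ?thesis unfolding disj_dom_number_def by (rule LeastI_ex)
qed

section \<open>Vertex classes around a dominating set of a tree\<close>

locale dd_tree =
  fixes V :: "'a set" and E :: "'a set set" and D :: "'a set"
  assumes tree: "is_tree V E" and two_vertices: "card V \<ge> 2"
    and D_subset: "D \<subseteq> V" and dominated: "\<And>v. v \<in> V \<Longrightarrow> v \<notin> D \<Longrightarrow> dd_dominated E D v"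
begin

lemma graph: "simple_graph V E" and acyclic: "\<not> has_cycle V E" and conn: "connected_graph V E"
  using tree by (auto simp: is_tree_def)

lemma finite_V: "finite V"
  using graph by (simp add: simple_graph_def)

lemma adjD: "adj E u v \<Longrightarrow> u \<noteq> v" "adj E u v \<Longrightarrow> u \<in> V" "adj E u v \<Longrightarrow> v \<in> V"
  using simple_graph_adjD[OF graph] by blast+

lemma crossing_edge:
  assumes "S \<subseteq> V" "S \<noteq> {}" "S \<noteq> V"
  obtains v w where "v \<in> S" "w \<notin> S" "adj E v w"
proof -
  obtain a b where ab: "a \<in> S" "b \<in> V - S" using assms by blast
  then obtain xs where "walk V E xs" "hd xs = a" "last xs = b"
    using conn assms unfolding connected_graph_def by blast
  then show thesis using walk_crossing_edge[of V E xs S] ab that by blast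
qed

abbreviation "leafset \<equiv> leaves V E"

lemma leaf_nbr_unique: "v \<in> leafset \<Longrightarrow> adj E v a \<Longrightarrow> adj E v b \<Longrightarrow> a = b"
  by (metis (mono_tags, lifting) card_1_singletonE degree_def leaves_def mem_Collect_eq mem_nbhd singletonD)

text \<open>Connectedness and the presence of two vertices exclude degree 0, so a non-leaf has
  degree at least 2 and one neighbour can be avoided.\<close>

lemma nonleaf_other_nbr:
  assumes v: "v \<in> V" "v \<notin> leafset"
  obtains w where "adj E v w" "w \<noteq> a"
proof -
  have "{v} \<noteq> V" using two_vertices by auto
  then obtain b where b: "adj E v b" using crossing_edge[of "{v}"] v by auto
  have "\<not> nbhd E v \<subseteq> {a}"
  proof
    assume "nbhd E v \<subseteq> {a}"
    then have "nbhd E v = {b}" using b by (metis empty_iff mem_nbhd subset_singletonD singletonD)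
    then show False using v by (simp add: leaves_def degree_def)
  qed
  then obtain w where "w \<in> nbhd E v" "w \<noteq> a" by blast
  then show thesis using that by simp
qed

definition X where "X = D \<union> (V - leafset)"
definition C1 where "C1 = {v \<in> V - leafset. v \<notin> D \<and> (\<exists>d\<in>D. adj E v d)}"
definition C0 where "C0 = {v \<in> V - leafset. v \<notin> D \<and> (\<forall>d\<in>D. \<not> adj E v d)}"
text \<open>The vertices of \<open>C0\<close> that have charge to give away; in the equality case
  they turn out to be all of \<open>C0\<close>.\<close>

definition C2 where "C2 = {u \<in> C0. card (nbhd E u \<inter> C1) \<ge> 2}"

lemma X_eq: "X = D \<union> C1 \<union> C0"
  by (auto simp: X_def C1_def C0_def)

lemma finite_parts: "finite D" "finite C1" "finite C0" "finite C2"
  using finite_V D_subset finite_subset[of _ V] by (auto simp: C1_def C0_def C2_def)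

lemma parts_disjoint: "D \<inter> C1 = {}" "(D \<union> C1) \<inter> C0 = {}" "C1 \<inter> C0 = {}"
  by (auto simp: C1_def C0_def)

lemma finite_nbhds: "finite (nbhd E v)"
  using finite_nbhd[OF graph] .

lemma card_nbhd_ge_2:
  assumes "a \<in> A" "b \<in> A" "a \<noteq> b" "adj E v a" "adj E v b"
  shows "card (nbhd E v \<inter> A) \<ge> 2"
proof -
  have "card {a, b} \<le> card (nbhd E v \<inter> A)"
    using assms finite_nbhds[of v] by (intro card_mono) auto
  then show ?thesis using assms by simp
qed

lemma card_nbhd_ge_1:
  assumes "a \<in> A" "adj E v a"
  shows "card (nbhd E v \<inter> A) \<ge> 1"
  using assms finite_nbhds[of v] by (auto simp: Suc_le_eq card_gt_0_iff)

text \<open>A leaf outside \<open>D\<close> is dominated only through its unique neighbour.\<close>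

lemma two_D_nbrs_of_leaf_nbr:
  assumes "y \<in> leafset" "y \<notin> D" "adj E v y" "v \<notin> D"
  shows "card (nbhd E v \<inter> D) \<ge> 2"
proof -
  have y: "adj E y v" "y \<in> V" using assms by (auto simp: adj_commute leaves_def)
  have only: "w = v" if "adj E y w" for w using leaf_nbr_unique[OF assms(1)] that y by blast
  then have "\<not> (\<exists>u\<in>D. adj E y u)" using assms by blast
  then obtain d d' where "d \<in> D" "d' \<in> D" "d \<noteq> d'" "common_nbr E y d" "common_nbr E y d'"
    using dominated[of y] y assms by (auto simp: dd_dominated_def)
  then show ?thesis using only by (intro card_nbhd_ge_2[of d _ d']) (auto simp: common_nbr_def)
qed

text \<open>The middle vertices of the two walks that dominate \<open>v\<close> are adjacent both to
  \<open>v\<close> and to a vertex of \<open>D\<close>, hence are no leaves. They may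
  coincide.\<close>

lemma C0_nbr_C1:
  assumes v: "v \<in> C0"
  obtains d d' w w' where "d \<in> D" "d' \<in> D" "d \<noteq> d'" "w \<in> C1" "w' \<in> C1"
    "adj E v w" "adj E v w'" "adj E w d" "adj E w' d'"
proof -
  have vV: "v \<in> V" "v \<notin> D" and no: "\<And>d. d \<in> D \<Longrightarrow> \<not> adj E v d"
    using v by (auto simp: C0_def)
  then obtain d d' w w' where *: "d \<in> D" "d' \<in> D" "d \<noteq> d'"
    "adj E v w" "adj E w d" "adj E v w'" "adj E w' d'"
    using dominated[of v] by (auto simp: dd_dominated_def common_nbr_def)
  have "w \<in> C1" if "adj E v w" "adj E w d" "d \<in> D" for w d
  proof -
    have "w \<notin> leafset" using leaf_nbr_unique[of w v d] that vV by (auto simp: adj_commute)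
    then show ?thesis using that no adjD by (auto simp: C1_def)
  qed
  then show thesis using * that by blast
qed

lemma C0_C1_pos: "v \<in> C0 \<Longrightarrow> card (nbhd E v \<inter> C1) \<ge> 1"
  by (meson C0_nbr_C1 card_nbhd_ge_1)

text \<open>A leaf outside \<open>D\<close> at \<open>v\<close> would give \<open>v\<close> two
  neighbours in \<open>D\<close>.\<close>

lemma C0_no_leaf_nbr:
  assumes "v \<in> C0" "adj E v y" "y \<notin> D"
  shows "y \<notin> leafset"
proof
  assume "y \<in> leafset"
  then have "card (nbhd E v \<inter> D) \<ge> 2" using two_D_nbrs_of_leaf_nbr[of y v] assms by (auto simp: C0_def)
  moreover have "nbhd E v \<inter> D = {}" using assms by (auto simp: C0_def)
  ultimately show False by simp
qed

lemma C0_nbhd: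
  assumes "v \<in> C0"
  shows "nbhd E v \<subseteq> C1 \<union> C0"
proof
  fix y assume y: "y \<in> nbhd E v"
  then have "y \<notin> D" using assms by (auto simp: C0_def)
  then show "y \<in> C1 \<union> C0"
    using C0_no_leaf_nbr[OF assms, of y] y adjD by (auto simp: C1_def C0_def)
qed

text \<open>With a single neighbour \<open>c\<close> in \<open>C1\<close>, the second neighbour of
  the non-leaf \<open>v\<close> must lie in \<open>C0\<close>, and both vertices of \<open>D\<close>
  that dominate \<open>v\<close> are reached through \<open>c\<close>.\<close>

lemma C0_not_C2:
  assumes v: "v \<in> C0" "v \<notin> C2"
  shows "card (nbhd E v \<inter> C1) = 1" "card (nbhd E v \<inter> C0) \<ge> 1"
    "\<And>w. w \<in> C1 \<Longrightarrow> adj E v w \<Longrightarrow> card (nbhd E w \<inter> D) \<ge> 2"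
proof -
  show one: "card (nbhd E v \<inter> C1) = 1" using C0_C1_pos[of v] v by (auto simp: C2_def)
  obtain c where c: "nbhd E v \<inter> C1 = {c}" using one by (rule card_1_singletonE)
  note only = nbhd_Int_singletonD[OF c]
  obtain y where y: "adj E v y" "y \<noteq> c"
    using nonleaf_other_nbr[of v c] v by (auto simp: C0_def)
  then have "y \<notin> C1" using only by blast
  then have "y \<in> C0" using C0_nbhd[OF v(1)] y by auto
  then show "card (nbhd E v \<inter> C0) \<ge> 1" using y card_nbhd_ge_1 by blast
  fix w assume w: "w \<in> C1" "adj E v w"
  show "card (nbhd E w \<inter> D) \<ge> 2"
  proof (rule C0_nbr_C1[OF v(1)])
    fix d d' a b
    assume "d \<in> D" "d' \<in> D" "d \<noteq> d'" and ab: "a \<in> C1" "b \<in> C1" "adj E v a" "adj E v b"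
      and "adj E a d" "adj E b d'"
    moreover have "a = w" using only[OF ab(3,1)] only[OF w(2,1)] by simp
    moreover have "b = w" using only[OF ab(4,2)] only[OF w(2,1)] by simp
    ultimately show ?thesis using card_nbhd_ge_2[of d D d'] by blast
  qed
qed

lemma C1_D_pos: "v \<in> C1 \<Longrightarrow> card (nbhd E v \<inter> D) \<ge> 1"
  using card_nbhd_ge_1 by (force simp: C1_def)

lemma C1_nbhd:
  assumes v: "v \<in> C1" and p: "card (nbhd E v \<inter> D) = 1"
  shows "nbhd E v \<subseteq> D \<union> C1 \<union> C0"
proof
  fix y assume y: "y \<in> nbhd E v"
  have "v \<notin> D" using v by (auto simp: C1_def)
  then show "y \<in> D \<union> C1 \<union> C0"
    using two_D_nbrs_of_leaf_nbr[of y v] p y adjD(3)[of v y] by (auto simp: C1_def C0_def)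
qed

text \<open>Besides its neighbour in \<open>D\<close> the non-leaf \<open>v\<close> has another one,
  \<open>y\<close>, which can only lie in \<open>C0\<close>. If \<open>y\<close> were outside
  \<open>C2\<close>, then \<open>C0_not_C2\<close> would give \<open>v\<close> two neighbours in
  \<open>D\<close>.\<close>

lemma C1_C2_pos:
  assumes v: "v \<in> C1" and p: "card (nbhd E v \<inter> D) = 1" and q: "card (nbhd E v \<inter> C1) = 0"
  shows "card (nbhd E v \<inter> C2) \<ge> 1"
proof -
  obtain d where d: "nbhd E v \<inter> D = {d}" using p by (rule card_1_singletonE)
  obtain y where y: "adj E v y" "y \<noteq> d"
    using nonleaf_other_nbr[of v d] v by (auto simp: C1_def)
  have "nbhd E v \<inter> C1 = {}" using q finite_nbhds[of v] by auto
  moreover have "y \<notin> D" using nbhd_Int_singletonD[OF d] y by blast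
  ultimately have "y \<notin> C1" "y \<notin> D" using y by auto
  then have y0: "y \<in> C0" using C1_nbhd[OF v p] y by (auto simp: subset_iff)
  have "y \<in> C2" using C0_not_C2(3)[OF y0, of v] v p y by (auto simp: adj_commute)
  then show ?thesis using y card_nbhd_ge_1 by blast
qed

section \<open>Discharging and the lower bound\<close>

text \<open>The edges of the forest induced by \<open>X\<close> are counted from both ends. Every vertex \<open>u\<close> of
  \<open>C2\<close> then passes 2 units of its surplus to each neighbour in \<open>C1\<close>, after which every vertex of
  \<open>C1\<close> and \<open>C0\<close> has nonnegative balance \<open>balance1\<close> resp. \<open>balance0\<close>.\<close>

definition balance1 :: "'a \<Rightarrow> int" where
  "balance1 v = 6 * int (card (nbhd E v \<inter> D)) + 3 * int (card (nbhd E v \<inter> C1))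
          + 2 * int (card (nbhd E v \<inter> C2)) - 8"

definition balance0 :: "'a \<Rightarrow> int" where
  "balance0 v = 6 * int (card (nbhd E v \<inter> C1)) + 3 * int (card (nbhd E v \<inter> C0)) - 8
          - (if v \<in> C2 then 2 * int (card (nbhd E v \<inter> C1)) else 0)"

text \<open>Two neighbours in \<open>D\<close> already contribute 12 against 8. With only one, the
  missing 2 units come from a neighbour in \<open>C1\<close> or, by \<open>C1_C2_pos\<close>, from
  one in \<open>C2\<close>.\<close>

lemma balance1_nonneg:
  assumes "v \<in> C1"
  shows "balance1 v \<ge> 0"
    "balance1 v = 0 \<Longrightarrow> card (nbhd E v \<inter> D) = 1 \<and> card (nbhd E v \<inter> C1) = 0 \<and> card (nbhd E v \<inter> C2) = 1"
  using C1_D_pos[OF assms] C1_C2_pos[OF assms] unfolding balance1_def by linarith+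

text \<open>A vertex of \<open>C2\<close> keeps 4 units for each of at least two neighbours in
  \<open>C1\<close>, which covers 8. A vertex outside \<open>C2\<close> has 6 units from
  \<open>C1\<close> and at least 3 from \<open>C0\<close>, so its balance is strictly
  positive.\<close>

lemma balance0_nonneg:
  assumes "v \<in> C0"
  shows "balance0 v \<ge> 0"
    "balance0 v = 0 \<Longrightarrow> v \<in> C2 \<and> card (nbhd E v \<inter> C1) = 2 \<and> card (nbhd E v \<inter> C0) = 0"
proof -
  let ?s = "card (nbhd E v \<inter> C1)" and ?t = "card (nbhd E v \<inter> C0)"
  have "balance0 v \<ge> 0 \<and> (balance0 v = 0 \<longrightarrow> v \<in> C2 \<and> ?s = 2 \<and> ?t = 0)"
  proof (cases "v \<in> C2")
    case True
    then have "?s \<ge> 2" "balance0 v = 4 * int ?s + 3 * int ?t - 8" by (auto simp: C2_def balance0_def)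
    then show ?thesis using True by linarith
  next
    case False
    then have "balance0 v = 3 * int ?t - 2" "?t \<ge> 1"
      using C0_not_C2(1,2)[OF assms] by (auto simp: balance0_def)
    then show ?thesis by linarith
  qed
  then show "balance0 v \<ge> 0" "balance0 v = 0 \<Longrightarrow> v \<in> C2 \<and> ?s = 2 \<and> ?t = 0" by blast+
qed

lemma D_nonempty: "D \<noteq> {}"
proof -
  obtain v where "v \<in> V" using two_vertices by fastforce
  then show ?thesis using dominated[of v] by (auto simp: dd_dominated_def)
qed

lemma card_nbhd_Un:
  "A \<inter> B = {} \<Longrightarrow> card (nbhd E v \<inter> (A \<union> B)) = card (nbhd E v \<inter> A) + card (nbhd E v \<inter> B)"
  using finite_nbhds[of v] by (subst card_Un_disjoint[symmetric]) (auto simp: Int_Un_distrib)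

lemma card_X: "card X = card D + card C1 + card C0"
  unfolding X_eq using parts_disjoint finite_parts by (simp add: card_Un_disjoint)

lemma discharging:
  "2 * int (card X) + 3 * (\<Sum>u\<in>D. int (card (nbhd E u \<inter> D))) + (\<Sum>u\<in>C1. balance1 u) + (\<Sum>u\<in>C0. balance0 u)
     \<le> 8 * int (card D) - 6"
proof -
  let ?s = "\<lambda>P Q. \<Sum>u\<in>P. int (card (nbhd E u \<inter> Q))"
  have swap: "?s P Q = ?s Q P" if "finite P" "finite Q" for P Q
    using sum_card_nbhd_swap[OF that, of E] by (simp flip: of_nat_sum)
  have split: "int (card (nbhd E u \<inter> X)) = int (card (nbhd E u \<inter> D)) + int (card (nbhd E u \<inter> C1))
      + int (card (nbhd E u \<inter> C0))" for u
    unfolding X_eq using parts_disjoint by (simp add: card_nbhd_Un)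
  have splitsum: "?s P X = ?s P D + ?s P C1 + ?s P C0" for P
    by (simp add: split sum.distrib)
  have X: "X \<subseteq> V" "X \<noteq> {}" using D_subset D_nonempty by (auto simp: X_def)
  have "int (degree_sum E X) + 2 \<le> 2 * int (card X)"
    using forest_degree_sum[OF graph acyclic X] by linarith
  moreover have "int (degree_sum E X) = ?s X X" by (simp add: degree_sum_def)
  moreover have "?s X X = ?s D X + ?s C1 X + ?s C0 X"
    unfolding X_eq using parts_disjoint finite_parts by (simp add: sum.union_disjoint)
  ultimately have main: "?s D D + ?s D C1 + ?s D C0 + (?s C1 D + ?s C1 C1 + ?s C1 C0)
      + (?s C0 D + ?s C0 C1 + ?s C0 C0) + 2 \<le> 2 * int (card X)"
    by (simp add: splitsum)
  have sw: "?s D C1 = ?s C1 D" "?s C1 C0 = ?s C0 C1" "?s C1 C2 = ?s C2 C1"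
    by (intro swap finite_parts)+
  have nn: "?s D C0 \<ge> 0" "?s C0 D \<ge> 0" by (auto intro: sum_nonneg)
  have balance1: "(\<Sum>u\<in>C1. balance1 u) = 6 * ?s C1 D + 3 * ?s C1 C1 + 2 * ?s C1 C2 - 8 * int (card C1)"
    by (simp add: balance1_def sum.distrib sum_subtractf sum_distrib_left)
  have "C0 \<inter> C2 = C2" by (auto simp: C2_def)
  then have "(\<Sum>u\<in>C0. if u \<in> C2 then 2 * int (card (nbhd E u \<inter> C1)) else 0) = 2 * ?s C2 C1"
    using finite_parts by (simp add: sum.If_cases sum_distrib_left)
  then have balance0: "(\<Sum>u\<in>C0. balance0 u) = 6 * ?s C0 C1 + 3 * ?s C0 C0 - 8 * int (card C0) - 2 * ?s C2 C1"
    by (simp add: balance0_def sum.distrib sum_subtractf sum_distrib_left)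
  \<comment> \<open>Three times the forest bound, with \<open>8 * K\<close> split over the three
    vertex classes. The transfer \<open>r\<close> between \<open>C2\<close> and \<open>C1\<close>
    cancels, and the 6 is three times the 2 of that bound.\<close>
  have arith: "2 * K + 3 * a + (6 * p + 3 * q + 2 * r - 8 * c) + (6 * s + 3 * t - 8 * c' - 2 * r) \<le> 8 * k - 6"
    if "a + p + y + (p + q + s) + (z + s + t) + 2 \<le> 2 * K" "0 \<le> y" "0 \<le> z" "K = k + c + c'"
    for K a p q r c s t c' k y z :: int
    using that by (simp add: algebra_simps)
  show ?thesis using arith[OF main[unfolded sw] nn] unfolding balance1 balance0 sw by (simp add: card_X)
qed

lemma card_leaves: "card V = card (V - leafset) + card leafset"
  using finite_V by (subst card_Diff_subset) (auto simp: leaves_def card_mono intro: finite_subset)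

lemma card_nonleaves_le: "card (V - leafset) \<le> card X"
  using finite_V D_subset by (intro card_mono) (auto simp: X_def finite_subset)

text \<open>Discarding the nonnegative terms of \<open>discharging\<close> leaves
  \<open>card X \<le> 4 * card D - 3\<close>, and \<open>X\<close> contains every non-leaf.\<close>

lemma lower_bound: "card V + 3 \<le> 4 * card D + card leafset"
proof -
  have "(\<Sum>u\<in>C1. balance1 u) \<ge> 0" "(\<Sum>u\<in>C0. balance0 u) \<ge> 0" "(\<Sum>u\<in>D. int (card (nbhd E u \<inter> D))) \<ge> 0"
    using balance1_nonneg balance0_nonneg by (auto intro: sum_nonneg)
  then show ?thesis using discharging card_leaves card_nonleaves_le by linarith
qed

section \<open>Structure in the equality case\<close>

text \<open>The equation leaves no slack in \<open>discharging\<close>: \<open>X\<close> is no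
  larger than the set of non-leaves, and all the nonnegative sums vanish term by term. The zero
  cases of the two balance lemmas then give the local structure.\<close>

lemma equality_structure:
  assumes eq: "card V + 3 = 4 * card D + card leafset"
  shows "D \<inter> leafset = {}"
    "\<And>u v. u \<in> D \<Longrightarrow> v \<in> D \<Longrightarrow> \<not> adj E u v"
    "\<And>v. v \<in> C1 \<Longrightarrow> card (nbhd E v \<inter> D) = 1 \<and> nbhd E v \<inter> C1 = {} \<and> card (nbhd E v \<inter> C0) = 1"
    "\<And>v. v \<in> C0 \<Longrightarrow> nbhd E v \<subseteq> C1 \<and> card (nbhd E v) = 2"
proof -
  have nn: "(\<Sum>u\<in>C1. balance1 u) \<ge> 0" "(\<Sum>u\<in>C0. balance0 u) \<ge> 0" "(\<Sum>u\<in>D. int (card (nbhd E u \<inter> D))) \<ge> 0"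
    using balance1_nonneg balance0_nonneg by (auto intro: sum_nonneg)
  then have z: "(\<Sum>u\<in>C1. balance1 u) = 0" "(\<Sum>u\<in>C0. balance0 u) = 0" "(\<Sum>u\<in>D. int (card (nbhd E u \<inter> D))) = 0"
    and X: "card X = card (V - leafset)"
    using discharging card_leaves card_nonleaves_le eq by linarith+
  have "finite X" using finite_parts by (simp add: X_eq)
  then have "X = V - leafset" using X by (intro card_subset_eq[symmetric]) (auto simp: X_def)
  then show "D \<inter> leafset = {}" by (auto simp: X_def)
  show "\<not> adj E u v" if "u \<in> D" "v \<in> D" for u v
    using z(3) that finite_parts(1) card_nbhd_ge_1[of v D u]
    by (subst (asm) sum_nonneg_eq_0_iff) auto
  have balance1: "balance1 v = 0" if "v \<in> C1" for v
    using z(1) that finite_parts balance1_nonneg by (subst (asm) sum_nonneg_eq_0_iff) auto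
  have balance0: "balance0 v = 0" if "v \<in> C0" for v
    using z(2) that finite_parts balance0_nonneg by (subst (asm) sum_nonneg_eq_0_iff) auto
  \<comment> \<open>This turns the single neighbour in \<open>C2\<close> of a vertex of
    \<open>C1\<close> into its only neighbour in \<open>C0\<close>.\<close>
  have "C2 = C0" using balance0 balance0_nonneg(2) by (auto simp: C2_def)
  then show "card (nbhd E v \<inter> D) = 1 \<and> nbhd E v \<inter> C1 = {} \<and> card (nbhd E v \<inter> C0) = 1"
    if "v \<in> C1" for v
    using balance1_nonneg(2)[OF that balance1[OF that]] finite_nbhds[of v] by auto
  show "nbhd E v \<subseteq> C1 \<and> card (nbhd E v) = 2" if "v \<in> C0" for v
  proof -
    have c: "card (nbhd E v \<inter> C1) = 2" "nbhd E v \<inter> C0 = {}"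
      using balance0_nonneg(2)[OF that balance0[OF that]] finite_nbhds[of v] by auto
    then have "nbhd E v \<subseteq> C1" using C0_nbhd[OF that] by blast
    then show ?thesis using c by (simp add: Int_absorb2)
  qed
qed

section \<open>Growing the labeled tree inside the given one\<close>

text \<open>The invariant of the growth. The \<open>degree_sum\<close> equation ensures that a
  vertex attached to \<open>S\<close> brings exactly one edge; the clauses on statuses restrict
  where an edge leaving \<open>S\<close> can start.\<close>

definition grown :: "'a set \<Rightarrow> ('a \<Rightarrow> status) \<Rightarrow> bool" where
  "grown S sta \<longleftrightarrow> S \<subseteq> V \<and> S \<noteq> {} \<and> degree_sum E S + 2 = 2 * card S \<and>
     in_T1 S (induced_edges E S) sta \<and>
     (\<forall>v\<in>S. sta v = SA \<longleftrightarrow> v \<in> D) \<and>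
     (\<forall>v\<in>S. sta v = SC \<longrightarrow> (\<exists>d\<in>D \<inter> S. adj E v d)) \<and>
     (\<forall>v\<in>S. sta v = SB \<or> sta v = SD \<longrightarrow> nbhd E v \<subseteq> S)"

context
  assumes eq: "card V + 3 = 4 * card D + card leafset"
begin

lemmas eq_facts = equality_structure[OF eq]

lemma D_other_nbr:
  assumes "d \<in> D"
  obtains w where "adj E d w" "w \<noteq> a"
  using nonleaf_other_nbr[of d a] eq_facts(1) D_subset assms by blast

text \<open>A vertex of \<open>D\<close> is no leaf, so it has two neighbours; these avoid the
  independent set \<open>D\<close> and form the initial path with it.\<close>

lemma grown_start: "\<exists>S sta. grown S sta"
proof -
  obtain d where d: "d \<in> D" using D_nonempty by blast
  obtain x where x: "adj E d x" using D_other_nbr[OF d] by metis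
  obtain z where z: "adj E d z" "z \<noteq> x" using D_other_nbr[OF d] by metis
  have V: "d \<in> V" "x \<in> V" "z \<in> V" "x \<noteq> d" "z \<noteq> d" using adjD x z by blast+
  have nD: "x \<notin> D" "z \<notin> D" using eq_facts(2) d x z by blast+
  have 1: "degree_sum E {d} + 2 = 2 * card {d}" using degree_sum_singleton[OF graph] by simp
  have ax: "nbhd E x \<inter> {d} = {d}" "degree_sum E {x, d} + 2 = 2 * card {x, d}"
    using subtree_insert[OF graph acyclic _ 1, of d x] x V by blast+
  have az: "nbhd E z \<inter> {x, d} = {d}" "degree_sum E {z, x, d} + 2 = 2 * card {z, x, d}"
    using subtree_insert[OF graph acyclic _ ax(2), of d z] z V by blast+
  let ?sta = "\<lambda>u. if u = d then SA else SC"
  have "induced_edges E {z, x, d} = {{x, d}, {d, z}}"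
    using induced_edges_insert[OF graph ax(1)] induced_edges_insert[OF graph az(1)]
      induced_edges_singleton[OF graph, of d] by (simp add: insert_commute)
  moreover have "in_T1 {x, d, z} {{x, d}, {d, z}} ?sta"
    using V z by (intro in_T1.base) auto
  ultimately have "in_T1 {z, x, d} (induced_edges E {z, x, d}) ?sta"
    by (simp add: insert_commute)
  then have "grown {z, x, d} ?sta"
    using az(2) V nD d x z by (auto simp: grown_def adj_commute)
  then show ?thesis by blast
qed

lemma C1_unique:
  assumes "v \<in> C1"
  shows "d \<in> D \<Longrightarrow> d' \<in> D \<Longrightarrow> adj E v d \<Longrightarrow> adj E v d' \<Longrightarrow> d = d'"
    "c \<in> C0 \<Longrightarrow> c' \<in> C0 \<Longrightarrow> adj E v c \<Longrightarrow> adj E v c' \<Longrightarrow> c = c'"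
    "adj E v y \<Longrightarrow> y \<in> D \<or> y \<in> C0"
proof -
  have same: "a = b" if "card A = 1" "a \<in> A" "b \<in> A" for A and a b :: 'a
    using that by (metis card_1_singletonE singletonD)
  show "d = d'" if "d \<in> D" "d' \<in> D" "adj E v d" "adj E v d'"
    using same[of "nbhd E v \<inter> D" d d'] eq_facts(3)[OF assms] that by simp
  show "c = c'" if "c \<in> C0" "c' \<in> C0" "adj E v c" "adj E v c'"
    using same[of "nbhd E v \<inter> C0" c c'] eq_facts(3)[OF assms] that by simp
  show "y \<in> D \<or> y \<in> C0" if "adj E v y"
  proof -
    have "y \<in> D \<union> C1 \<union> C0" using C1_nbhd[OF assms] eq_facts(3)[OF assms] that by auto
    moreover have "y \<notin> C1" using eq_facts(3)[OF assms] that mem_nbhd[of y E v] by blast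
    ultimately show ?thesis by blast
  qed
qed

text \<open>An edge from \<open>v\<close> in \<open>S\<close> to \<open>w\<close> outside is
  extended by \<open>op1\<close> if \<open>v\<close> is in \<open>D\<close>. Otherwise
  \<open>v\<close> is in \<open>C1\<close>, and \<open>w\<close> in \<open>C0\<close>,
  \<open>v2\<close> in \<open>C1\<close>, \<open>d2\<close> in \<open>D\<close> and a further
  neighbour \<open>w2\<close> of \<open>d2\<close> serve as \<open>u1\<close> to \<open>u4\<close>
  in \<open>op3\<close>.\<close>

lemma grown_step:
  assumes gr: "grown S sta" and ne: "S \<noteq> V"
  shows "\<exists>S' sta'. grown S' sta' \<and> S \<subset> S'"
proof -
  have S: "S \<subseteq> V" "S \<noteq> {}" "degree_sum E S + 2 = 2 * card S" "in_T1 S (induced_edges E S) sta"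
    and A: "\<And>v. v \<in> S \<Longrightarrow> sta v = SA \<longleftrightarrow> v \<in> D"
    and C: "\<And>v. v \<in> S \<Longrightarrow> sta v = SC \<Longrightarrow> \<exists>d\<in>D \<inter> S. adj E v d"
    and BD: "\<And>v. v \<in> S \<Longrightarrow> sta v = SB \<or> sta v = SD \<Longrightarrow> nbhd E v \<subseteq> S"
    using gr unfolding grown_def by blast+
  obtain v w where vw: "v \<in> S" "w \<notin> S" "adj E v w" using crossing_edge[of S] S ne by blast
  have wV: "w \<in> V" using vw adjD by blast
  note w1 = subtree_insert[OF graph acyclic S(1,3) vw]
  have ind1: "induced_edges E (insert w S) = insert {w, v} (induced_edges E S)"
    using induced_edges_insert[OF graph w1(1)] .
  show ?thesis
  proof (cases "v \<in> D")
    case True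
    let ?sta = "sta(w := SC)"
    have "w \<notin> D" using eq_facts(2) True vw by blast
    have "in_T1 (insert w S) (induced_edges E (insert w S)) ?sta"
      unfolding ind1 using S(4) vw A True by (intro in_T1.op1[where sta = sta]) auto
    moreover have new: "?sta w = SC" "\<And>u. u \<in> S \<Longrightarrow> ?sta u = sta u" using vw by auto
    moreover have "adj E w v" using vw by (simp add: adj_commute)
    then have "\<forall>u\<in>insert w S. ?sta u = SC \<longrightarrow> (\<exists>d\<in>D \<inter> insert w S. adj E u d)"
      using C new True vw by (metis Int_iff insert_iff)
    moreover have "\<forall>u\<in>insert w S. ?sta u = SA \<longleftrightarrow> u \<in> D"
      using A new \<open>w \<notin> D\<close> by (metis insert_iff status.distinct(4))
    moreover have "\<forall>u\<in>insert w S. ?sta u = SB \<or> ?sta u = SD \<longrightarrow> nbhd E u \<subseteq> insert w S"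
      using BD new by (metis insert_iff status.distinct(8,12) subset_insertI2)
    moreover have "insert w S \<subseteq> V" using S wV by blast
    ultimately have "grown (insert w S) ?sta"
      unfolding grown_def using w1(2) by blast
    then show ?thesis using vw by blast
  next
    case False
    have "w \<in> nbhd E v" using vw by simp
    \<comment> \<open>Statuses B and D would keep \<open>w\<close> inside \<open>S\<close>, and
      status A would put \<open>v\<close> into \<open>D\<close>.\<close>
    then have "sta v \<noteq> SB" "sta v \<noteq> SD" "sta v \<noteq> SA" using vw BD[of v] A[of v] False by blast+
    then have sv: "sta v = SC" by (cases "sta v") auto
    then obtain d where d: "d \<in> D" "d \<in> S" "adj E v d" using C vw by blast
    have "v \<notin> leafset" using leaf_nbr_unique[of v d w] d vw by blast
    then have v1: "v \<in> C1" using False d S vw by (auto simp: C1_def)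
    have "w \<notin> D" using C1_unique(1)[OF v1, of d w] d vw by blast
    then have w0: "w \<in> C0" using C1_unique(3)[OF v1, of w] vw by blast
    \<comment> \<open>The degree condition of \<open>op3\<close>: the neighbours of \<open>v\<close>
      are one vertex of \<open>D\<close>, which is \<open>d\<close>, and one of \<open>C0\<close>,
      which is \<open>w\<close> and lies outside \<open>S\<close>.\<close>
    have "x = d" if "adj E v x" "x \<in> S" for x
      using C1_unique(3)[OF v1, of x] C1_unique(1)[OF v1, of x d] C1_unique(2)[OF v1, of x w]
        that d vw w0 by blast
    then have "nbhd E v \<inter> S \<subseteq> {d}" by auto
    moreover have "{d} \<subseteq> nbhd E v \<inter> S" using d by auto
    ultimately have "nbhd E v \<inter> S = {d}" by (rule subset_antisym)
    then have deg: "degree (induced_edges E S) v = 1"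
      using vw by (simp add: degree_def nbhd_induced_edges)
    obtain v2 where v2: "nbhd E w = {v, v2}" "v2 \<noteq> v"
    proof -
      obtain a b where ab: "nbhd E w = {a, b}" "a \<noteq> b"
        using eq_facts(4)[OF w0] by (auto simp: card_2_iff)
      have "v \<in> nbhd E w" using vw by (simp add: adj_commute)
      then have "v = a \<or> v = b" unfolding ab by simp
      then show thesis
        using that[of a] that[of b] ab by (elim disjE) (simp_all add: insert_commute)
    qed
    have wv2: "adj E w v2" unfolding mem_nbhd[symmetric] v2(1) by simp
    have "v2 \<in> nbhd E w" using wv2 by simp
    then have v21: "v2 \<in> C1" using eq_facts(4)[OF w0] by blast
    obtain d2 where d2: "d2 \<in> D" "adj E v2 d2" using v21 by (auto simp: C1_def)
    obtain w2 where w2: "adj E d2 w2" "w2 \<noteq> v2" using D_other_nbr[OF d2(1)] by metis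
    have nD: "w2 \<notin> D" "v2 \<notin> D" using eq_facts(2) d2 w2 v21 by (auto simp: C1_def)
    \<comment> \<open>The closure clause for \<open>v2\<close>, which receives status B: its only
      neighbours are the one in \<open>C0\<close> and the one in \<open>D\<close>.\<close>
    have nv2: "nbhd E v2 \<subseteq> {w, d2}"
    proof
      fix x assume "x \<in> nbhd E v2"
      then show "x \<in> {w, d2}"
        using C1_unique(3)[OF v21, of x] C1_unique(1)[OF v21, of x d2] C1_unique(2)[OF v21, of x w]
          d2 wv2 w0 by (auto simp: adj_commute)
    qed
    let ?S1 = "insert w S"
    have S1: "?S1 \<subseteq> V" using S wV by blast
    \<comment> \<open>A new vertex already in the current set would be a second neighbour there of
      its predecessor, against \<open>subtree_insert\<close>. The same argument serves
      \<open>n3\<close> and \<open>n4\<close>.\<close>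
    have n2: "v2 \<notin> ?S1" using nbhd_Int_singletonD[OF w1(1) wv2] v2(2) adjD(1)[OF wv2] by blast
    note s2 = subtree_insert[OF graph acyclic S1 w1(2) insertI1 n2 wv2]
    let ?S2 = "insert v2 ?S1"
    have S2: "?S2 \<subseteq> V" using S1 adjD(3)[OF wv2] by simp
    have "d2 \<noteq> w" using d2 \<open>w \<notin> D\<close> by blast
    then have n3: "d2 \<notin> ?S2" using nbhd_Int_singletonD[OF s2(1) d2(2)] adjD(1)[OF d2(2)] by blast
    note s3 = subtree_insert[OF graph acyclic S2 s2(2) insertI1 n3 d2(2)]
    let ?S3 = "insert d2 ?S2"
    have S3: "?S3 \<subseteq> V" using S2 adjD(3)[OF d2(2)] by simp
    have n4: "w2 \<notin> ?S3" using nbhd_Int_singletonD[OF s3(1) w2(1)] w2(2) adjD(1)[OF w2(1)] by blast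
    note s4 = subtree_insert[OF graph acyclic S3 s3(2) insertI1 n4 w2(1)]
    let ?S4 = "insert w2 ?S3"
    have S4: "?S4 \<subseteq> V" using S3 adjD(3)[OF w2(1)] by simp
    have ind: "induced_edges E ?S4 =
        induced_edges E S \<union> {{w, v}, {w, v2}, {v2, d2}, {d2, w2}}"
      using ind1 induced_edges_insert[OF graph s2(1)] induced_edges_insert[OF graph s3(1)]
        induced_edges_insert[OF graph s4(1)] by (simp add: insert_commute)
    let ?sta = "sta(w := SD, v2 := SB, d2 := SA, w2 := SC)"
    have nS: "v2 \<notin> S" "d2 \<notin> S" "w2 \<notin> S" using n2 n3 n4 by blast+
    have dist: "distinct [w, v2, d2, w2]" using n2 n3 n4 by auto
    have "in_T1 (S \<union> {w, v2, d2, w2}) (induced_edges E ?S4) ?sta"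
      unfolding ind using S(4) vw nS sv deg dist by (intro in_T1.op3[where sta = sta]) auto
    moreover have "S \<union> {w, v2, d2, w2} = ?S4" by blast
    ultimately have T1: "in_T1 ?S4 (induced_edges E ?S4) ?sta" by simp
    have old: "?sta u = sta u" if "u \<in> S" for u using that vw nS by auto
    have new: "?sta w = SD" "?sta v2 = SB" "?sta d2 = SA" "?sta w2 = SC" using dist by auto
    have "adj E w2 d2" using w2 by (simp add: adj_commute)
    then have "\<forall>u\<in>?S4. ?sta u = SC \<longrightarrow> (\<exists>d\<in>D \<inter> ?S4. adj E u d)"
      using C old new d2 by (metis Int_iff insert_iff status.distinct(4,8,12))
    moreover have "\<forall>u\<in>?S4. ?sta u = SA \<longleftrightarrow> u \<in> D"
      using A old new d2 nD \<open>w \<notin> D\<close> by (metis insert_iff status.distinct(2,4,6))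
    moreover have "nbhd E u \<subseteq> ?S4" if u: "u \<in> ?S4" "?sta u = SB \<or> ?sta u = SD" for u
    proof -
      consider "u = w" | "u = v2" | "u \<in> S" using u new by (metis insert_iff status.distinct(2,6,8,12))
      then show ?thesis
      proof cases
        case 1
        then show ?thesis unfolding 1 v2(1) using vw by blast
      next
        case 2
        then show ?thesis using nv2 by blast
      next
        case 3
        then show ?thesis using BD[of u] old u by auto
      qed
    qed
    ultimately have "grown ?S4 ?sta"
      unfolding grown_def using S4 s4(2) T1 by blast
    then show ?thesis using vw by blast
  qed
qed

text \<open>Each growth step lowers the number of vertices still missing, so the process ends with
  all of \<open>V\<close>.\<close>

lemma ex_T1_labeling: "\<exists>sta. in_T1 V E sta"
proof -
  have "\<exists>sta. in_T1 V E sta" if "grown S sta" for S sta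
    using that
  proof (induction "card (V - S)" arbitrary: S sta rule: less_induct)
    case less
    have sub: "S \<subseteq> V" using less.prems by (simp add: grown_def)
    show ?case
    proof (cases "S = V")
      case True
      have "induced_edges E V = E"
        using graph by (fastforce simp: induced_edges_def simple_graph_def)
      then show ?thesis using less.prems True by (auto simp: grown_def)
    next
      case False
      then obtain S' sta' where S': "grown S' sta'" "S \<subset> S'" using grown_step less.prems by blast
      then have "S' \<subseteq> V" by (simp add: grown_def)
      then have "V - S' \<subset> V - S" using S' sub by blast
      then have "card (V - S') < card (V - S)" using finite_V by (intro psubset_card_mono) auto
      then show ?thesis using less.hyps S' by blast
    qed
  qed
  then show ?thesis using grown_start by blast
qed

end

end

section \<open>Trees of the family attain the bound\<close>

lemma dd_dominated_mono:
  assumes "dd_dominated E D v" "E \<subseteq> E'" "D \<subseteq> D'"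
  shows "dd_dominated E' D' v"
proof -
  have "adj E a b \<Longrightarrow> adj E' a b" for a b using assms by (auto simp: adj_def)
  then show ?thesis using assms unfolding dd_dominated_def common_nbr_def by (meson subsetD)
qed

definition status_A :: "'a set \<Rightarrow> ('a \<Rightarrow> status) \<Rightarrow> 'a set" where
  "status_A V sta = {v \<in> V. sta v = SA}"

lemma nbhd_empty: "nbhd {} v = {}"
  by (simp add: nbhd_def adj_def)

lemma nbhd_outside: "simple_graph V E \<Longrightarrow> u \<notin> V \<Longrightarrow> nbhd E u = {}"
  using simple_graph_adjD by fastforce

lemma simple_graph_insert:
  assumes "simple_graph V E" "v \<in> V" "u \<notin> V"
  shows "simple_graph (insert u V) (insert {u, v} E)"
proof -
  have "\<exists>a b. e = {a, b} \<and> a \<noteq> b \<and> a \<in> insert u V \<and> b \<in> insert u V" if "e \<in> insert {u, v} E" for e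
    using that assms unfolding simple_graph_def by blast
  then show ?thesis using assms by (simp add: simple_graph_def)
qed

text \<open>The claims are carried through the induction together. Degree at least 2 at status A
  means that the first operation adds a leaf and destroys none; an A-neighbour at every C-vertex is
  what dominates \<open>u1\<close> in the second operation. That operation adds four vertices and
  one of status A, while \<open>u4\<close> replaces \<open>v\<close> as a leaf.\<close>

lemma in_T1_status_A:
  assumes "in_T1 V E sta"
  shows "simple_graph V E \<and> (\<forall>v\<in>status_A V sta. degree E v \<ge> 2) \<and>
    (\<forall>v\<in>V. sta v = SC \<longrightarrow> (\<exists>d\<in>status_A V sta. adj E v d)) \<and>
    (\<forall>v\<in>V - status_A V sta. dd_dominated E (status_A V sta) v) \<and>
    4 * card (status_A V sta) + card (leaves V E) = card V + 3"
  using assms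
proof (induction rule: in_T1.induct)
  case (base x y z sta)
  let ?E = "{{x, y}, {y, z}}"
  have A: "status_A {x, y, z} sta = {y}" using base by (auto simp: status_A_def)
  have n: "nbhd ?E x = {y}" "nbhd ?E y = {x, z}" "nbhd ?E z = {y}"
    using base by (auto simp: nbhd_insert_edge nbhd_empty)
  have adj: "adj ?E x y" "adj ?E z y" by (auto simp: adj_def insert_commute)
  have "leaves {x, y, z} ?E = {x, z}" using n base by (auto simp: leaves_def degree_def)
  moreover have "simple_graph {x, y, z} ?E" using base by (auto simp: simple_graph_def)
  moreover have "degree ?E y = 2" using n base by (simp add: degree_def)
  ultimately show ?case unfolding A using base adj by (auto simp: dd_dominated_def)
next
  case (op1 V E sta v u sta')
  let ?E = "insert {u, v} E" and ?A = "status_A V sta"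
  have G: "simple_graph V E" using op1.IH by blast
  then have fin: "finite V" by (simp add: simple_graph_def)
  have uv: "u \<noteq> v" using op1 by blast
  have A: "status_A (insert u V) sta' = ?A" using op1.hyps by (auto simp: status_A_def)
  have vA: "v \<in> ?A" using op1.hyps by (simp add: status_A_def)
  have adj_mono: "adj E a b \<Longrightarrow> adj ?E a b" for a b by (auto simp: adj_def)
  have "nbhd ?E u = {v}" "nbhd ?E v = insert u (nbhd E v)"
    "\<And>x. x \<noteq> u \<Longrightarrow> x \<noteq> v \<Longrightarrow> nbhd ?E x = nbhd E x"
    using uv nbhd_outside[OF G op1.hyps(4)] by (auto simp: nbhd_insert_edge)
  moreover have "u \<notin> nbhd E v" using nbhd_subset[OF G] op1.hyps by blast
  ultimately have deg: "degree ?E u = 1" "degree ?E v = Suc (degree E v)"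
    "\<And>x. x \<noteq> u \<Longrightarrow> x \<noteq> v \<Longrightarrow> degree ?E x = degree E x"
    using finite_nbhd[OF G, of v] by (auto simp: degree_def)
  have "degree E v \<ge> 2" using op1.IH vA by blast
  have "leaves (insert u V) ?E = insert u (leaves V E)"
  proof (intro set_eqI)
    fix x
    consider "x = u" | "x = v" | "x \<noteq> u" "x \<noteq> v" by blast
    then show "x \<in> leaves (insert u V) ?E \<longleftrightarrow> x \<in> insert u (leaves V E)"
      by cases (use deg uv \<open>degree E v \<ge> 2\<close> in \<open>auto simp: leaves_def\<close>)
  qed
  moreover have "u \<notin> leaves V E" "finite (leaves V E)" using op1.hyps fin by (auto simp: leaves_def)
  ultimately have "4 * card ?A + card (leaves (insert u V) ?E) = card (insert u V) + 3"
    using op1 fin by simp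
  moreover have "degree ?E x \<ge> 2" if "x \<in> ?A" for x
  proof -
    have "x \<noteq> u" "degree E x \<ge> 2" using that op1 by (auto simp: status_A_def)
    then show ?thesis using deg by (cases "x = v") auto
  qed
  moreover have "adj ?E u v" by (simp add: adj_def)
  moreover from this have "dd_dominated ?E ?A u" using vA by (auto simp: dd_dominated_def)
  moreover have "\<forall>x\<in>V - ?A. dd_dominated ?E ?A x"
    using op1.IH dd_dominated_mono[of E _ _ ?E] by blast
  moreover have "\<forall>x\<in>V. sta' x = SC \<longrightarrow> (\<exists>d\<in>?A. adj ?E x d)"
    using op1 adj_mono by metis
  moreover have "simple_graph (insert u V) ?E" using simple_graph_insert[OF G] op1.hyps by blast
  ultimately show ?case unfolding A using vA by blast
next
  case (op3 V E sta v u1 u2 u3 u4 sta')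
  let ?V = "V \<union> {u1, u2, u3, u4}" and ?E = "E \<union> {{u1, v}, {u1, u2}, {u2, u3}, {u3, u4}}"
  let ?A = "status_A V sta"
  have G: "simple_graph V E" using op3.IH by blast
  then have fin: "finite V" by (simp add: simple_graph_def)
  have new: "u1 \<notin> V" "u2 \<notin> V" "u3 \<notin> V" "u4 \<notin> V" "distinct [u1, u2, u3, u4]"
    and v: "v \<in> V" "degree E v = 1" "sta v = SC"
    using op3.hyps by blast+
  have neq: "u1 \<noteq> v" "u2 \<noteq> v" "u3 \<noteq> v" "u4 \<noteq> v" using new v by blast+
  have A: "status_A ?V sta' = insert u3 ?A" using op3.hyps by (auto simp: status_A_def)
  have eqE: "?E = insert {u4, u3} (insert {u3, u2} (insert {u2, u1} (insert {u1, v} E)))"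
    by (auto simp: insert_commute)
  have eqV: "?V = insert u4 (insert u3 (insert u2 (insert u1 V)))" by auto
  have G': "simple_graph ?V ?E"
    unfolding eqE eqV using new v by (intro simple_graph_insert G) auto
  have adj_mono: "adj E a b \<Longrightarrow> adj ?E a b" for a b by (auto simp: adj_def)
  have adj: "adj ?E u1 v" "adj ?E u1 u2" "adj ?E u2 u3" "adj ?E u4 u3"
    by (auto simp: adj_def insert_commute)
  have nb: "nbhd ?E u1 = {v, u2}" "nbhd ?E u2 = {u1, u3}" "nbhd ?E u3 = {u2, u4}" "nbhd ?E u4 = {u3}"
    "nbhd ?E v = insert u1 (nbhd E v)"
    unfolding eqE using new neq by (auto simp: nbhd_insert_edge nbhd_outside[OF G])
  have "nbhd ?E x = nbhd E x" if "x \<in> V" "x \<noteq> v" for x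
    unfolding eqE using new that by (auto simp: nbhd_insert_edge)
  then have deg_old: "degree ?E x = degree E x" if "x \<in> V" "x \<noteq> v" for x
    using that by (simp add: degree_def)
  have "u1 \<notin> nbhd E v" using nbhd_subset[OF G] new by blast
  then have deg: "degree ?E u1 = 2" "degree ?E u2 = 2" "degree ?E u3 = 2" "degree ?E u4 = 1"
    "degree ?E v = 2"
    using nb new neq v finite_nbhd[OF G, of v] by (auto simp: degree_def)
  have "leaves ?V ?E = insert u4 (leaves V E - {v})"
  proof (intro set_eqI)
    fix x
    consider "x \<in> V" "x \<noteq> v" | "x = v" | "x \<in> {u1, u2, u3, u4}" | "x \<notin> ?V" by blast
    then show "x \<in> leaves ?V ?E \<longleftrightarrow> x \<in> insert u4 (leaves V E - {v})"
      by cases (use new v deg deg_old in \<open>auto simp: leaves_def\<close>)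
  qed
  moreover have "v \<in> leaves V E" "u4 \<notin> leaves V E" "finite (leaves V E)"
    using v new fin by (auto simp: leaves_def)
  ultimately have cl: "card (leaves ?V ?E) = card (leaves V E)"
    using card_Suc_Diff1[of "leaves V E" v] by simp
  have "finite ?A" "u3 \<notin> ?A" using fin new by (auto simp: status_A_def)
  moreover have "card ?V = card V + 4" unfolding eqV using fin new by (auto simp: eq_commute)
  ultimately have c: "4 * card (insert u3 ?A) + card (leaves ?V ?E) = card ?V + 3"
    using cl op3.IH by simp
  have dg: "degree ?E x \<ge> 2" if "x \<in> insert u3 ?A" for x
    using that deg deg_old op3.IH by (cases "x = v") (auto simp: status_A_def)
  obtain d where d: "d \<in> ?A" "adj E v d" using op3.IH v by blast
  \<comment> \<open>The two dominators of \<open>u1\<close> are \<open>d\<close>, reached through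
    \<open>v\<close>, and \<open>u3\<close>, reached through \<open>u2\<close>.\<close>
  have "common_nbr ?E u1 d" "common_nbr ?E u1 u3" "d \<noteq> u3"
    using adj adj_mono[OF d(2)] d(1) new by (auto simp: common_nbr_def status_A_def)
  then have "dd_dominated ?E (insert u3 ?A) u1" using d by (auto simp: dd_dominated_def)
  moreover have "dd_dominated ?E (insert u3 ?A) u2" "dd_dominated ?E (insert u3 ?A) u4"
    using adj by (auto simp: dd_dominated_def)
  moreover have "dd_dominated ?E (insert u3 ?A) x" if "x \<in> V - ?A" for x
    using op3.IH that dd_dominated_mono[of E ?A x ?E "insert u3 ?A"] by blast
  ultimately have dom: "\<forall>x\<in>?V - insert u3 ?A. dd_dominated ?E (insert u3 ?A) x" by blast
  have "\<forall>x\<in>?V. sta' x = SC \<longrightarrow> (\<exists>d\<in>insert u3 ?A. adj ?E x d)"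
  proof (intro ballI impI)
    fix x assume "x \<in> ?V" "sta' x = SC"
    then have "x = u4 \<or> x \<in> V \<and> sta x = SC" using op3.hyps by auto
    then show "\<exists>d\<in>insert u3 ?A. adj ?E x d" using adj(4) adj_mono op3.IH by blast
  qed
  then show ?case unfolding A using G' c dom dg by blast
qed

theorem theorem2p3:
  fixes V :: "'a set" and E :: "'a set set"
  assumes "is_tree V E" and "card V \<ge> 2"
  shows "real (disj_dom_number V E) \<ge> (real (card V) - real (card (leaves V E)) + 3) / 4
       \<and> (real (disj_dom_number V E) = (real (card V) - real (card (leaves V E)) + 3) / 4
            \<longleftrightarrow> (\<exists>S. in_T1 V E S))"
proof -
  obtain D where D: "disj_dom_set V E D" "card D = disj_dom_number V E"
    using disj_dom_number_attained by blast
  interpret dd_tree V E D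
    using assms D(1)[unfolded disj_dom_set_iff[OF assms(1)]] by unfold_locales blast+
  \<comment> \<open>In a tree of the family, \<open>status_A\<close> is a dominating set that
    attains the bound. Minimality of \<open>D\<close> together with \<open>lower_bound\<close>
    forces \<open>card D\<close> to the same value.\<close>
  have "card V + 3 = 4 * card D + card (leaves V E)" if T: "in_T1 V E S" for S
  proof -
    let ?A = "status_A V S"
    have "disj_dom_set V E ?A"
      using in_T1_status_A[OF T] disj_dom_set_iff[OF assms(1)] by (auto simp: status_A_def)
    then have "card D \<le> card ?A" using disj_dom_number_le D(2) by metis
    then show ?thesis using in_T1_status_A[OF T] lower_bound by linarith
  qed
  then have "card V + 3 = 4 * card D + card (leaves V E) \<longleftrightarrow> (\<exists>S. in_T1 V E S)"
    using ex_T1_labeling by blast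
  moreover have "real (card D) = (real (card V) - real (card (leaves V E)) + 3) / 4 \<longleftrightarrow>
      card V + 3 = 4 * card D + card (leaves V E)"
    by (simp add: field_simps) linarith
  moreover have "real (card V) + 3 \<le> 4 * real (card D) + real (card (leaves V E))"
    using lower_bound by linarith
  ultimately show ?thesis using D(2) by (simp add: field_simps)
qed

end
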